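(* Let $r \in \mathbb{Q}_{>0}$, let $S = \{s_0 = 0 < s_1 < s_2 < \cdots\} \subseteq \mathbb{N}_0$ be infinite, and let $M_{r,S} = \langle r^{s_n} \mid n \in \mathbb{N}_0 \rangle$ be the additive submonoid of $\mathbb{Q}_{\geq 0}$ generated by the powers $r^{s_n}$. Suppose that $M_{r,S}$ is atomic. Then the following statements are equivalent. (1) $M_{r,S}$ satisfies the finite factorization property (FFP). (2) $M_{r,S}$ satisfies the bounded factorization property (BFP). (3) $M_{r,S}$ satisfies the ascending chain condition on principal ideals (ACCP).
   Context: Let $M$ be a commutative, cancellative, reduced additive monoid. An atom of $M$ is a nonzero $a \in M$ such that $a = x+y$ with $x,y\in M$ implies $x=0$ or $y=0$; $\mathcal{A}(M)$ is the set of atoms, and $M$ is atomic if it is generated by $\mathcal{A}(M)$. $\mathsf{Z}(M)$ is the free commutative monoid on $\mathcal{A}(M)$, and $\pi\colon \mathsf{Z}(M)\to M$ is the monoid homomorphism with $\pi(a)=a$ for each atom $a$. If $z = a_1 + \cdots + a_n \in \mathsf{Z}(M)$ with $a_i \in \mathcal{A}(M)$, then $|z| = n$ is its length. For $x \in M$, $\mathsf{Z}(x) = \pi^{-1}(x)$ is the set of factorizations of $x$ and $\mathsf{L}(x) = \{|z| : z \in \mathsf{Z}(x)\}$. $M$ satisfies the FFP if $\mathsf{Z}(x)$ is nonempty and finite for all $x\in M$, and the BFP if $\mathsf{L}(x)$ is nonempty and finite for all $x \in M$. A principal ideal of $M$ is a set of the form $x + M$ with $x\in M$; $M$ satisfies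 the ACCP if every increasing sequence of principal ideals of $M$ eventually stabilizes. *)

theory Defs
  imports Complex_Main "HOL.Hull" "HOL-Library.Multiset"
begin

text \<open>A monoid is a subset of a cancellative commutative additive type that contains zero and is
  closed under addition, so commutativity and cancellativity come from the type class.\<close>

definition add_submonoid :: "'a::cancel_comm_monoid_add set \<Rightarrow> bool" where
  "add_submonoid M \<longleftrightarrow> 0 \<in> M \<and> (\<forall>x\<in>M. \<forall>y\<in>M. x + y \<in> M)"

definition reduced :: "'a::cancel_comm_monoid_add set \<Rightarrow> bool" where
  "reduced M \<longleftrightarrow> (\<forall>x\<in>M. \<forall>y\<in>M. x + y = 0 \<longrightarrow> x = 0)"

definition generated_monoid :: "'a::cancel_comm_monoid_add set \<Rightarrow> 'a set" where
  "generated_monoid G = add_submonoid hull G"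

definition atoms :: "'a::cancel_comm_monoid_add set \<Rightarrow> 'a set" where
  "atoms M = {a \<in> M. a \<noteq> 0 \<and> (\<forall>x\<in>M. \<forall>y\<in>M. a = x + y \<longrightarrow> x = 0 \<or> y = 0)}"

definition atomic :: "'a::cancel_comm_monoid_add set \<Rightarrow> bool" where
  "atomic M \<longleftrightarrow> generated_monoid (atoms M) = M"

text \<open>The free commutative monoid on the atoms is realised by the finite multisets of atoms;
  the canonical homomorphism to the monoid is then \<^const>\<open>sum_mset\<close>, and the length of a
  factorization is its \<^const>\<open>size\<close>.\<close>

definition factorization_monoid :: "'a::cancel_comm_monoid_add set \<Rightarrow> 'a multiset set" where
  "factorization_monoid M = {z. set_mset z \<subseteq> atoms M}"

definition factorizations :: "'a::cancel_comm_monoid_add set \<Rightarrow> 'a \<Rightarrow> 'a multiset set" where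
  "factorizations M x = {z \<in> factorization_monoid M. sum_mset z = x}"

definition lengths :: "'a::cancel_comm_monoid_add set \<Rightarrow> 'a \<Rightarrow> nat set" where
  "lengths M x = size ` factorizations M x"

definition FFP :: "'a::cancel_comm_monoid_add set \<Rightarrow> bool" where
  "FFP M \<longleftrightarrow> (\<forall>x\<in>M. factorizations M x \<noteq> {} \<and> finite (factorizations M x))"

definition BFP :: "'a::cancel_comm_monoid_add set \<Rightarrow> bool" where
  "BFP M \<longleftrightarrow> (\<forall>x\<in>M. lengths M x \<noteq> {} \<and> finite (lengths M x))"

definition principal_ideal :: "'a::cancel_comm_monoid_add set \<Rightarrow> 'a set \<Rightarrow> bool" where
  "principal_ideal M I \<longleftrightarrow> (\<exists>x\<in>M. I = (+) x ` M)"

definition ACCP :: "'a::cancel_comm_monoid_add set \<Rightarrow> bool" where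
  "ACCP M \<longleftrightarrow> (\<forall>I :: nat \<Rightarrow> 'a set.
     (\<forall>n. principal_ideal M (I n)) \<and> (\<forall>n. I n \<subseteq> I (Suc n)) \<longrightarrow> (\<exists>N. \<forall>n\<ge>N. I n = I N))"

definition power_monoid :: "rat \<Rightarrow> nat set \<Rightarrow> rat set" where
  "power_monoid r S = generated_monoid {r ^ s | s. s \<in> S}"

text \<open>For positive \<open>r\<close> the monoid \<^term>\<open>power_monoid r S\<close> is a reduced submonoid of the
  nonnegative rationals, as the theory above presupposes.\<close>

lemma add_submonoid_power_monoid: "add_submonoid (power_monoid r S)"
  unfolding power_monoid_def generated_monoid_def
  by (rule hull_in) (auto simp: add_submonoid_def)

lemma power_monoid_nonneg:
  assumes "r > 0"
  shows "power_monoid r S \<subseteq> {0..}"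
  unfolding power_monoid_def generated_monoid_def
  by (rule hull_minimal) (use assms in \<open>auto simp: add_submonoid_def\<close>)

lemma reduced_power_monoid:
  assumes "r > 0"
  shows "reduced (power_monoid r S)"
  unfolding reduced_def
proof (intro ballI impI)
  fix x y
  assume "x \<in> power_monoid r S" "y \<in> power_monoid r S" and "x + y = 0"
  moreover from this have "x \<ge> 0" "y \<ge> 0"
    using power_monoid_nonneg[OF assms, of S] by auto
  ultimately show "x = 0"
    by linarith
qed

end

theory Submission
  imports Defs
begin

text \<open>The implications FFP to BFP to ACCP hold in every reduced monoid. For the converse, suppose
  that \<open>x\<close> has infinitely many factorizations into powers \<open>r ^ i\<close> with \<open>i \<ge> n\<close>. The multiplicity of
  \<open>r ^ n\<close> in them is bounded, so infinitely many share the same multiplicity \<open>c\<close>, and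
  \<open>x - c r ^ n\<close> has infinitely many factorizations into powers \<open>r ^ i\<close> with \<open>i > n\<close>. Iterating gives
  an ascending chain of principal ideals. If it stabilizes, then some \<open>t \<noteq> 0\<close> is, for every
  large \<open>n\<close>, a sum of powers \<open>r ^ i\<close> with \<open>i \<ge> n\<close>, so the numerator of \<open>t\<close> is divisible by
  arbitrarily high powers of the numerator of \<open>r\<close>; this is impossible unless \<open>r = 1 / b\<close>. In that
  case atomicity forces \<open>r = 1\<close>.\<close>

section \<open>Generated monoids, atoms and factorizations in reduced monoids\<close>

lemma sum_mset_in_submonoid:
  assumes "add_submonoid M" "set_mset z \<subseteq> M"
  shows "sum_mset z \<in> M"
  using assms(2)
  by (induction z) (use assms(1) in \<open>auto simp: add_submonoid_def\<close>)

text \<open>Makes the hull concrete: the finite sums over \<open>G\<close> form a submonoid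
  containing \<open>G\<close>, so minimality of the hull gives one direction and closure under sums
  the other.\<close>

lemma in_generated_monoid_iff:
  "x \<in> generated_monoid G \<longleftrightarrow> (\<exists>z. set_mset z \<subseteq> G \<and> sum_mset z = x)"
proof
  let ?N = "{x. \<exists>z. set_mset z \<subseteq> G \<and> sum_mset z = x}"
  have "add_submonoid ?N"
    unfolding add_submonoid_def
  proof (intro conjI ballI)
    show "0 \<in> ?N"
      by (auto intro: exI[of _ "{#}"])
    fix x y assume "x \<in> ?N" "y \<in> ?N"
    then obtain z w where "set_mset z \<subseteq> G" "sum_mset z = x" "set_mset w \<subseteq> G" "sum_mset w = y"
      by auto
    then show "x + y \<in> ?N"
      by (intro CollectI exI[of _ "z + w"]) auto
  qed
  moreover have "G \<subseteq> ?N"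
  proof
    fix g assume "g \<in> G"
    then show "g \<in> ?N"
      by (auto intro: exI[of _ "{#g#}"])
  qed
  ultimately have "generated_monoid G \<subseteq> ?N"
    unfolding generated_monoid_def by (intro hull_minimal)
  then show "x \<in> generated_monoid G \<Longrightarrow> \<exists>z. set_mset z \<subseteq> G \<and> sum_mset z = x"
    by auto
next
  have "add_submonoid (generated_monoid G)" "G \<subseteq> generated_monoid G"
    unfolding generated_monoid_def
    by (rule hull_in, auto simp: add_submonoid_def hull_inc)
  then show "\<exists>z. set_mset z \<subseteq> G \<and> sum_mset z = x \<Longrightarrow> x \<in> generated_monoid G"
    using sum_mset_in_submonoid by blast
qed

lemma atomic_iff_factorizations_nonempty:
  assumes "add_submonoid M"
  shows "atomic M \<longleftrightarrow> (\<forall>x\<in>M. factorizations M x \<noteq> {})"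
proof -
  have "generated_monoid (atoms M) \<subseteq> M"
    unfolding generated_monoid_def
    by (rule hull_minimal) (use assms in \<open>auto simp: atoms_def\<close>)
  then show ?thesis
    by (auto simp: atomic_def factorizations_def factorization_monoid_def set_eq_iff
        in_generated_monoid_iff subset_iff)
qed

text \<open>Peel generators off a sum representing the atom: either the removed generator is 0 and
  the shorter sum still represents the atom, or the rest sums to 0 and the atom is that
  generator.\<close>

lemma atoms_generated_subset:
  assumes "reduced (generated_monoid G)"
  shows "atoms (generated_monoid G) \<subseteq> G"
proof
  fix a assume a: "a \<in> atoms (generated_monoid G)"
  then obtain z where z: "set_mset z \<subseteq> G" "sum_mset z = a"
    by (auto simp: atoms_def in_generated_monoid_iff)
  then show "a \<in> G"
  proof (induction z)
    case empty
    then show ?case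
      using a by (auto simp: atoms_def)
  next
    case (add g z)
    have "g \<in> generated_monoid G" "sum_mset z \<in> generated_monoid G"
      using add.prems by (auto simp: in_generated_monoid_iff intro: exI[of _ "{#g#}"])
    then have "g = 0 \<or> sum_mset z = 0"
      using a add.prems by (auto simp: atoms_def)
    then show ?case
      using add by auto
  qed
qed

lemma factorizations_zero:
  assumes "add_submonoid M" "reduced M"
  shows "factorizations M 0 = {{#}}"
proof -
  have "z = {#}" if z: "set_mset z \<subseteq> atoms M" "sum_mset z = 0" for z
  proof (cases z)
    case (add a w)
    then have "a \<in> M" "a \<noteq> 0" "set_mset w \<subseteq> M" "a + sum_mset w = 0"
      using z by (auto simp: atoms_def)
    then show ?thesis
      using assms sum_mset_in_submonoid[of M w] by (auto simp: reduced_def)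
  qed
  then show ?thesis
    by (auto simp: factorizations_def factorization_monoid_def)
qed

text \<open>Each generator lies in the other's ideal; cancellation makes the two differences sum to
  0, and reducedness makes them vanish. A stabilizing chain of ideals thus has eventually constant
  generators.\<close>

lemma principal_ideal_eqD:
  assumes "add_submonoid M" "reduced M" "(+) x ` M = (+) y ` M"
  shows "x = y"
proof -
  have "x \<in> (+) x ` M" "y \<in> (+) y ` M"
    using assms(1) by (auto simp: add_submonoid_def intro: image_eqI[of _ _ 0])
  then have "x \<in> (+) y ` M" "y \<in> (+) x ` M"
    by (simp_all only: assms(3))
  then obtain u v where uv: "u \<in> M" "v \<in> M" "x = y + u" "y = x + v"
    by (elim imageE)
  then have "x + (v + u) = x + 0"
    by (metis add.assoc add.right_neutral)
  then have "v + u = 0"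
    by (simp only: add_left_cancel)
  then show ?thesis
    using assms(2) uv by (auto simp: reduced_def)
qed

section \<open>From FFP to BFP to ACCP\<close>

lemma FFP_imp_BFP: "FFP M \<Longrightarrow> BFP M"
  by (auto simp: FFP_def BFP_def lengths_def)

text \<open>Joining a longest factorization of \<open>x\<close> with a nonempty one of
  \<open>y\<close> gives a longer factorization of \<open>x + y\<close>. So the maximal length drops
  along strict inclusions of principal ideals.\<close>

lemma Max_lengths_add_less:
  assumes "BFP M" "add_submonoid M" "x \<in> M" "y \<in> M" "y \<noteq> 0"
  shows "Max (lengths M x) < Max (lengths M (x + y))"
proof -
  have xy: "x + y \<in> M"
    using assms by (auto simp: add_submonoid_def)
  have "Max (lengths M x) \<in> lengths M x"
    using assms by (intro Max_in) (auto simp: BFP_def)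
  then obtain z where z: "z \<in> factorizations M x" "size z = Max (lengths M x)"
    by (auto simp: lengths_def)
  have "lengths M y \<noteq> {}"
    using assms by (auto simp: BFP_def)
  then obtain w where w: "w \<in> factorizations M y"
    by (auto simp: lengths_def)
  then have "w \<noteq> {#}"
    using \<open>y \<noteq> 0\<close> by (auto simp: factorizations_def)
  have "z + w \<in> factorizations M (x + y)"
    using z w by (auto simp: factorizations_def factorization_monoid_def)
  then have "size (z + w) \<in> lengths M (x + y)"
    unfolding lengths_def by (rule imageI)
  then have "size (z + w) \<le> Max (lengths M (x + y))"
    using assms xy by (intro Max_ge) (auto simp: BFP_def)
  moreover have "size w > 0"
    using \<open>w \<noteq> {#}\<close> by (simp add: nonempty_has_size)
  ultimately show ?thesis
    using z by simp
qed

lemma BFP_imp_ACCP: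
  assumes "BFP M" "add_submonoid M"
  shows "ACCP M"
  unfolding ACCP_def
proof (intro allI impI, elim conjE)
  fix I :: "nat \<Rightarrow> 'a set"
  assume "\<forall>n. principal_ideal M (I n)" and inc: "\<forall>n. I n \<subseteq> I (Suc n)"
  then obtain x where x: "\<And>n. x n \<in> M" "\<And>n. I n = (+) (x n) ` M"
    unfolding principal_ideal_def by metis
  \<comment> \<open>\<open>N\<close> minimises the maximal length along the chain, so no strict
    inclusion can follow it.\<close>
  obtain N where N: "\<And>n. Max (lengths M (x N)) \<le> Max (lengths M (x n))"
    using ex_has_least_nat[of "\<lambda>_. True" 0 "\<lambda>n. Max (lengths M (x n))"] by auto
  have "I n = I N" if "n \<ge> N" for n
  proof -
    have "x N \<in> I N"
      using assms(2) x by (auto simp: add_submonoid_def intro: image_eqI[of _ _ 0])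
    then have "x N \<in> I n"
      using inc that lift_Suc_mono_le[of I] by blast
    then obtain y where y: "y \<in> M" "x N = x n + y"
      using x by auto
    then have "y = 0"
      using Max_lengths_add_less[OF assms x(1)[of n] y(1)] N[of n] by fastforce
    then show ?thesis
      using x y by simp
  qed
  then show "\<exists>N. \<forall>n\<ge>N. I n = I N"
    by blast
qed

section \<open>Tail factorizations and numerators at least 2\<close>

text \<open>A high power of \<open>b\<close> clears all denominators, and every resulting term keeps
  the factor \<open>a ^ n\<close>. Since \<open>a\<close> and \<open>b\<close> are coprime, this
  factor survives in the reduced numerator.\<close>

lemma numerator_power_dvd_sum_powers:
  fixes r :: rat
  assumes r: "r = of_int a / of_int b" "b > 0" "coprime a b"
    and z: "\<forall>u\<in>#z. \<exists>i\<ge>n. u = r ^ i"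
  shows "a ^ n dvd fst (quotient_of (sum_mset z))"
proof -
  have "\<exists>m N. sum_mset z * of_int b ^ m = of_int (a ^ n * N)"
    using z
  proof (induction z)
    case empty
    then show ?case
      by (auto intro: exI[of _ 0])
  next
    case (add u z)
    then obtain m N where mN: "sum_mset z * of_int b ^ m = of_int (a ^ n * N)"
      by auto
    obtain i where i: "i \<ge> n" "u = r ^ i"
      using add.prems by auto
    have "u * of_int b ^ i = of_int (a ^ i)"
      using r i by (simp add: power_divide)
    moreover have "a ^ i = a ^ n * a ^ (i - n)"
      using i by (simp flip: power_add)
    ultimately have u: "u * of_int b ^ i = of_int (a ^ n * a ^ (i - n))"
      by simp
    have "(u + sum_mset z) * of_int b ^ (m + i) =
        (u * of_int b ^ i) * of_int b ^ m + (sum_mset z * of_int b ^ m) * of_int b ^ i"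
      by (simp add: power_add algebra_simps)
    also have "\<dots> = of_int (a ^ n * a ^ (i - n)) * of_int b ^ m + of_int (a ^ n * N) * of_int b ^ i"
      by (simp only: u mN)
    also have "\<dots> = of_int (a ^ n * (a ^ (i - n) * b ^ m + N * b ^ i))"
      by (simp add: algebra_simps)
    finally show ?case
      unfolding sum_mset.add_mset by (intro exI)
  qed
  then obtain m N where mN: "sum_mset z * of_int b ^ m = of_int (a ^ n * N)"
    by blast
  obtain p q where pq: "quotient_of (sum_mset z) = (p, q)"
    by force
  then have "q > 0" "sum_mset z = of_int p / of_int q"
    using quotient_of_denom_pos quotient_of_div by auto
  then have "(of_int (p * b ^ m) :: rat) = of_int q * (sum_mset z * of_int b ^ m)"
    by simp
  also have "\<dots> = of_int (a ^ n * (N * q))"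
    by (simp add: mN)
  finally have "p * b ^ m = a ^ n * (N * q)"
    by (simp only: of_int_eq_iff)
  then have "a ^ n dvd p * b ^ m"
    by simp
  moreover have "coprime (a ^ n) (b ^ m)"
    using r by simp
  ultimately show ?thesis
    using pq by (simp add: coprime_dvd_mult_left_iff)
qed

text \<open>The state of the iteration: infinitude of this set is passed from \<open>n\<close> to
  \<open>Suc n\<close> while \<open>x\<close> moves down to a divisor in \<open>M\<close>.\<close>

definition tail_factorizations :: "rat set \<Rightarrow> rat \<Rightarrow> nat \<Rightarrow> rat \<Rightarrow> rat multiset set" where
  "tail_factorizations M r n x = {z \<in> factorizations M x. \<forall>u\<in>#z. \<exists>i\<ge>n. u = r ^ i}"

lemma infinite_tail_factorizations_step:
  assumes r: "r > 0" and M: "add_submonoid M" "M \<subseteq> {0..}"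
    and inf: "infinite (tail_factorizations M r n x)"
  shows "\<exists>y. infinite (tail_factorizations M r (Suc n) y) \<and> (\<exists>c\<in>M. x = y + c)"
proof -
  let ?T = "tail_factorizations M r n x"
  have split: "z = replicate_mset (count z u) u + filter_mset (\<lambda>v. v \<noteq> u) z" for z and u :: rat
    by (intro multiset_eqI) auto
  have sums: "x = of_nat (count z (r ^ n)) * r ^ n + sum_mset (filter_mset (\<lambda>v. v \<noteq> r ^ n) z)"
    if "z \<in> ?T" for z
    using arg_cong[OF split[of z "r ^ n"], of sum_mset] that
    by (simp add: tail_factorizations_def factorizations_def)
  have sub: "set_mset z \<subseteq> M" if "z \<in> ?T" for z
    using that by (auto simp: tail_factorizations_def factorizations_def factorization_monoid_def
        atoms_def)
  \<comment> \<open>The remaining atoms sum to a nonnegative number, so the copies of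
    \<open>r ^ n\<close> alone cannot exceed \<open>x\<close>.\<close>
  have "count z (r ^ n) \<le> nat \<lfloor>x / r ^ n\<rfloor>" if z: "z \<in> ?T" for z
  proof -
    have "sum_mset (filter_mset (\<lambda>v. v \<noteq> r ^ n) z) \<in> M"
      using sub[OF z] by (intro sum_mset_in_submonoid[OF M(1)]) auto
    then have "of_nat (count z (r ^ n)) * r ^ n \<le> x"
      using sums[OF z] M(2) by auto
    then have "of_nat (count z (r ^ n)) \<le> x / r ^ n"
      using r by (simp add: field_simps)
    then show ?thesis
      by (simp add: le_nat_iff le_floor_iff)
  qed
  then have "(\<lambda>z. count z (r ^ n)) ` ?T \<subseteq> {..nat \<lfloor>x / r ^ n\<rfloor>}"
    by auto
  then have "finite ((\<lambda>z. count z (r ^ n)) ` ?T)"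
    by (rule finite_subset) simp
  then obtain z0 where z0: "z0 \<in> ?T"
    and inf': "infinite {z \<in> ?T. count z (r ^ n) = count z0 (r ^ n)}"
    using pigeonhole_infinite[OF inf] by blast
  let ?F = "{z \<in> ?T. count z (r ^ n) = count z0 (r ^ n)}"
  let ?f = "filter_mset (\<lambda>v. v \<noteq> r ^ n)"
  define c where "c = of_nat (count z0 (r ^ n)) * r ^ n"
  \<comment> \<open>All members of \<open>?F\<close> lose the same number of copies of
    \<open>r ^ n\<close>, so what remains determines the factorization.\<close>
  have "inj_on ?f ?F"
  proof (rule inj_onI)
    fix z w assume "z \<in> ?F" "w \<in> ?F" "?f z = ?f w"
    then show "z = w"
      using split[of z "r ^ n"] split[of w "r ^ n"] by simp
  qed
  then have "infinite (?f ` ?F)"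
    using inf' finite_image_iff by blast
  moreover have "?f ` ?F \<subseteq> tail_factorizations M r (Suc n) (x - c)"
  proof (rule image_subsetI)
    fix z assume z: "z \<in> ?F"
    then have "sum_mset (?f z) = x - c"
      using sums[of z] by (simp add: c_def)
    moreover have "\<exists>i\<ge>Suc n. v = r ^ i" if v: "v \<in># ?f z" for v
    proof -
      obtain i where "i \<ge> n" "v = r ^ i" "v \<noteq> r ^ n"
        using z v by (auto simp: tail_factorizations_def)
      then have "Suc n \<le> i"
        by (metis le_neq_implies_less Suc_leI)
      then show ?thesis
        using \<open>v = r ^ i\<close> by blast
    qed
    ultimately show "?f z \<in> tail_factorizations M r (Suc n) (x - c)"
      using z by (auto simp: tail_factorizations_def factorizations_def factorization_monoid_def)
  qed
  ultimately have "infinite (tail_factorizations M r (Suc n) (x - c))"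
    using finite_subset by blast
  moreover have "c \<in> M"
  proof -
    \<comment> \<open>If the multiplicity is 0, \<open>r ^ n\<close> may lie outside
      \<open>M\<close>; the multiset is then empty and \<open>c = 0\<close>.\<close>
    have "set_mset (replicate_mset (count z0 (r ^ n)) (r ^ n)) \<subseteq> M"
      using sub[OF z0] by (auto simp: in_replicate_mset)
    then show ?thesis
      using sum_mset_in_submonoid[OF M(1), of "replicate_mset (count z0 (r ^ n)) (r ^ n)"]
      by (simp add: c_def)
  qed
  ultimately show ?thesis
    by (intro exI[of _ "x - c"]) auto
qed

lemma finite_factorizations_of_ACCP:
  fixes r :: rat
  assumes r: "r = of_int a / of_int b" "b > 0" "coprime a b" and a: "a \<ge> 2"
    and M: "add_submonoid M" "M \<subseteq> {0..}" "reduced M" "atoms M \<subseteq> range ((^) r)"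
    and accp: "ACCP M"
  shows "finite (factorizations M x)"
proof (rule ccontr)
  assume inf: "infinite (factorizations M x)"
  have r0: "r > 0"
    unfolding r(1) using r(2) a by (intro divide_pos_pos) auto
  have "tail_factorizations M r 0 x = factorizations M x"
    using M(4) by (auto simp: tail_factorizations_def factorizations_def factorization_monoid_def)
  then have start: "\<exists>y. infinite (tail_factorizations M r 0 y)"
    using inf by metis
  \<comment> \<open>Dependent choice iterates the step; \<open>f n = f (Suc n) + c\<close> makes the
    ideals \<open>f n + M\<close> ascend.\<close>
  have "\<exists>f. \<forall>n. infinite (tail_factorizations M r n (f n)) \<and> (\<exists>c\<in>M. f n = f (Suc n) + c)"
    by (rule dependent_nat_choice)
      (fact start, fact infinite_tail_factorizations_step[OF r0 M(1,2)])
  then obtain f where f: "\<And>n. infinite (tail_factorizations M r n (f n))"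
    and step: "\<And>n. \<exists>c\<in>M. f n = f (Suc n) + c"
    by blast
  have ex: "\<exists>z\<in>factorizations M (f n). \<forall>u\<in>#z. \<exists>i\<ge>n. u = r ^ i" for n
    using infinite_imp_nonempty[OF f[of n]] by (auto simp: tail_factorizations_def)
  have fM: "f n \<in> M" for n
  proof -
    obtain z where z: "set_mset z \<subseteq> M" "sum_mset z = f n"
      using ex[of n] by (auto simp: factorizations_def factorization_monoid_def atoms_def)
    show ?thesis
      using sum_mset_in_submonoid[OF M(1) z(1)] z(2) by simp
  qed
  have "(+) (f n) ` M \<subseteq> (+) (f (Suc n)) ` M" for n
  proof -
    obtain c where c: "c \<in> M" "f n = f (Suc n) + c"
      using step by blast
    have "f n + y \<in> (+) (f (Suc n)) ` M" if "y \<in> M" for y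
      using that c M(1) by (intro image_eqI[of _ _ "c + y"]) (auto simp: add_submonoid_def)
    then show ?thesis
      by auto
  qed
  moreover have "principal_ideal M ((+) (f n) ` M)" for n
    using fM by (auto simp: principal_ideal_def)
  ultimately have "\<exists>N. \<forall>n\<ge>N. (+) (f n) ` M = (+) (f N) ` M"
    using accp[unfolded ACCP_def, rule_format, of "\<lambda>n. (+) (f n) ` M"] by blast
  then obtain N where N: "\<And>n. n \<ge> N \<Longrightarrow> (+) (f n) ` M = (+) (f N) ` M"
    by blast
  have const: "f n = f N" if "n \<ge> N" for n
    using principal_ideal_eqD[OF M(1,3) N[OF that]] .
  define p where "p = fst (quotient_of (f N))"
  \<comment> \<open>Only the empty multiset factors 0, whereas \<open>f N\<close> has infinitely
    many factorizations.\<close>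
  have "f N \<noteq> 0"
  proof
    assume "f N = 0"
    then have "tail_factorizations M r N (f N) \<subseteq> {{#}}"
      using factorizations_zero[OF M(1,3)] by (auto simp: tail_factorizations_def)
    then show False
      using f[of N] finite_subset by blast
  qed
  then have "p \<noteq> 0"
    unfolding p_def using quotient_of_div[of "f N" p "snd (quotient_of (f N))"]
    by (auto simp: p_def)
  have dvd: "a ^ n dvd p" if n: "n \<ge> N" for n
  proof -
    obtain z where "sum_mset z = f N" "\<forall>u\<in>#z. \<exists>i\<ge>n. u = r ^ i"
      using ex[of n] const[OF n] by (auto simp: factorizations_def)
    then show ?thesis
      using numerator_power_dvd_sum_powers[OF r, of z n] by (simp add: p_def)
  qed
  \<comment> \<open>Large enough for divisibility and for the contradiction \<open>\<bar>p\<bar>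
    \<le> n < 2 ^ n \<le> a ^ n \<le> \<bar>p\<bar>\<close>.\<close>
  define n where "n = max N (nat \<bar>p\<bar>)"
  have "a ^ n \<le> \<bar>p\<bar>"
    using dvd_imp_le_int[OF \<open>p \<noteq> 0\<close> dvd[of n]] a by (simp add: n_def)
  moreover have "int n < 2 ^ n"
    using of_nat_less_two_power by blast
  moreover have "(2::int) ^ n \<le> a ^ n"
    using a by (intro power_mono) auto
  moreover have "\<bar>p\<bar> \<le> int n"
    by (simp add: n_def)
  ultimately show False
    by linarith
qed

section \<open>Numerator 1 and the remaining case \<open>r = 1\<close>\<close>

text \<open>Every generator \<open>r ^ s\<close> is a sum of \<open>b ^ (t - s)\<close> copies of
  \<open>r ^ t\<close> for some larger \<open>t\<close> in \<open>S\<close>, so no generator is an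
  atom. Atoms being generators, atomicity would make the monoid trivial.\<close>

lemma not_atomic_power_monoid:
  assumes b: "b \<ge> 2" and S: "infinite S"
  shows "\<not> atomic (power_monoid (1 / of_nat b) S)"
proof
  define r :: rat where "r = 1 / of_nat b"
  let ?M = "power_monoid r S"
  have r0: "r > 0"
    using b by (simp add: r_def)
  assume "atomic (power_monoid (1 / of_nat b) S)"
  then have atomic: "generated_monoid (atoms ?M) = ?M"
    by (simp add: r_def atomic_def)
  have "r ^ s \<notin> atoms ?M" if "s \<in> S" for s
  proof
    assume atom: "r ^ s \<in> atoms ?M"
    obtain t where t: "t > s" "t \<in> S"
      using S by (auto simp: finite_nat_set_iff_bounded_le not_le)
    define k where "k = b ^ (t - s)"
    have "2 ^ 1 \<le> (2::nat) ^ (t - s)"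
      using t by (intro power_increasing) auto
    also have "\<dots> \<le> k"
      using b by (simp add: k_def power_mono)
    finally have k: "k \<ge> 2"
      by simp
    have "r ^ t = r ^ s * r ^ (t - s)"
      using t by (simp flip: power_add)
    also have "\<dots> = r ^ s / of_nat k"
      by (simp add: k_def r_def power_divide)
    finally have "r ^ s = of_nat k * r ^ t"
      using k by simp
    \<comment> \<open>Since \<open>k \<ge> 2\<close>, both summands are nonzero and the
      decomposition is proper.\<close>
    also have "\<dots> = r ^ t + of_nat (k - 1) * r ^ t"
      using k by (simp add: algebra_simps of_nat_diff)
    finally have eq: "r ^ s = r ^ t + of_nat (k - 1) * r ^ t" .
    have gen: "of_nat m * r ^ t \<in> ?M" for m
      unfolding power_monoid_def in_generated_monoid_iff
      using t by (intro exI[of _ "replicate_mset m (r ^ t)"]) (auto simp: in_replicate_mset)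
    have "r ^ t = 0 \<or> of_nat (k - 1) * r ^ t = 0"
      using atom eq gen[of 1] gen[of "k - 1"] unfolding atoms_def mem_Collect_eq by (metis mult_1 of_nat_1)
    then show False
      using r0 k by simp
  qed
  then have "atoms ?M = {}"
    using atoms_generated_subset reduced_power_monoid[OF r0, of S]
    unfolding power_monoid_def by blast
  then have "generated_monoid {} = ?M"
    using atomic by simp
  moreover have "generated_monoid {} = {0::rat}"
    by (rule set_eqI) (auto simp: in_generated_monoid_iff)
  ultimately have "?M = {0}"
    by simp
  moreover obtain s where "s \<in> S"
    using infinite_imp_nonempty[OF S] by blast
  then have "r ^ s \<in> ?M"
    unfolding power_monoid_def generated_monoid_def by (intro hull_inc) auto
  ultimately show False
    using r0 by auto
qed

text \<open>Serves \<open>r = 1\<close>: a sum of ones determines how many there are, so each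
  \<open>x\<close> has at most one factorization.\<close>

lemma finite_factorizations_of_atoms_singleton:
  assumes "atoms M \<subseteq> {1::rat}"
  shows "finite (factorizations M x)"
proof (rule finite_subset)
  show "factorizations M x \<subseteq> {replicate_mset (nat \<lfloor>x\<rfloor>) 1}"
  proof
    fix z assume "z \<in> factorizations M x"
    then have z: "set_mset z \<subseteq> {1}" "sum_mset z = x"
      using assms by (auto simp: factorizations_def factorization_monoid_def)
    obtain k where k: "z = replicate_mset k 1"
      using set_mset_subset_singletonD[OF z(1)] by metis
    then have "x = of_nat k"
      using z(2) by simp
    then show "z \<in> {replicate_mset (nat \<lfloor>x\<rfloor>) 1}"
      using k by simp
  qed
qed simp

text \<open>Case split on the numerator of \<open>r\<close> in lowest terms. Numerator 1 leaves only
  \<open>r = 1\<close>, because atomicity excludes a denominator of at least 2. Atomicity also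
  supplies the existence of factorizations.\<close>

lemma ACCP_imp_FFP_power_monoid:
  assumes r: "r > 0" and S: "infinite S" and atomic: "atomic (power_monoid r S)"
    and accp: "ACCP (power_monoid r S)"
  shows "FFP (power_monoid r S)"
proof -
  let ?M = "power_monoid r S"
  have atoms: "atoms ?M \<subseteq> {r ^ s | s. s \<in> S}"
    using atoms_generated_subset reduced_power_monoid[OF r, of S]
    unfolding power_monoid_def by blast
  obtain a b where ab: "quotient_of r = (a, b)"
    by force
  then have r': "r = of_int a / of_int b" "b > 0" "coprime a b"
    using quotient_of_div quotient_of_denom_pos quotient_of_coprime by auto
  then have "a > 0"
    using r by (simp add: zero_less_divide_iff)
  have "finite (factorizations ?M x)" for x
  proof (cases "a \<ge> 2")
    case True
    then show ?thesis
      using finite_factorizations_of_ACCP[OF r' True add_submonoid_power_monoid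
          power_monoid_nonneg[OF r] reduced_power_monoid[OF r] _ accp] atoms
      by blast
  next
    case False
    then have "r = 1 / of_nat (nat b)"
      using \<open>a > 0\<close> r' by simp
    then have "\<not> nat b \<ge> 2"
      using not_atomic_power_monoid[OF _ S, of "nat b"] atomic by auto
    then have "r = 1"
      using False \<open>a > 0\<close> r' by simp
    then show ?thesis
      using atoms by (intro finite_factorizations_of_atoms_singleton) auto
  qed
  then show ?thesis
    using atomic atomic_iff_factorizations_nonempty[OF add_submonoid_power_monoid]
    by (auto simp: FFP_def)
qed

theorem theorem3p10:
  fixes r :: rat and S :: "nat set"
  assumes "r > 0"
    and "infinite S" and "0 \<in> S"
    and "atomic (power_monoid r S)"
  shows "(FFP (power_monoid r S) \<longleftrightarrow> BFP (power_monoid r S)) \<and>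
         (BFP (power_monoid r S) \<longleftrightarrow> ACCP (power_monoid r S))"
  using FFP_imp_BFP BFP_imp_ACCP[OF _ add_submonoid_power_monoid]
    ACCP_imp_FFP_power_monoid[OF assms(1,2,4)]
  by blast

end
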